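(* Let $\Sigma_0=(J_n)_{n\ge 0}$ be the basic Fraenkel model of second order, i.e. $J_0=\mathbb{N}$ and, for $n\ge 1$, $J_n$ is the set of all $n$-ary predicates on $\mathbb{N}$ that have a finite support with respect to the group of all permutations of $\mathbb{N}$. Then $\Sigma_0\models choice_h^{1,1}(H)$ for every second-order formula $H\in\mathcal{L}^{(2)}_{x,D}$; that is, $\Sigma_0\models \mathrm{HAC}$, where $\mathrm{HAC}$ is the set of all 1-1 Ackermann axioms of choice.
   Context: Language: second-order formulas (the set $\mathcal{L}^{(2)}$) are built from individual variables, $n$-ary predicate variables for each $n\ge1$ ("variables of sort $n$"), identity between individuals, connectives, and quantifiers over individual variables and over predicate variables of every sort. $\mathcal{L}^{(2)}_{x,D}$ is the set of formulas $H=H(x,D)$ in which the individual variable $x$ and the unary predicate variable $D$ occur only free (i.e. not bound); $H$ may contain further free individual and predicate variables. Structures: for a non-empty set $I$, an $n$-ary predicate on $I$ is a function $\alpha:I^n\to\{true,false\}$, identified with a subset of $I^n$. A predicate structure over $I$ is a sequence $\Sigma=(J_n)_{n\ge0}$ with $J_0=I$ and each $J_n$ ($n\ge1$) a non-empty set of $n$-ary predicates on $I$. Individual variables range over $J_0$ and predicate variables of sort $n$ range over $J_n$ (Henkin semantics). An assignment maps each variable to an element of the corresponding domain. $\Sigma\models\varphi$ means that $\varphi$ is true in $\Sigma$ under every assignment. Permutation models: for a group $\mathfrak{G}$ of permutations of $I$ and $\pi\in\mathfrak{G}$, let $\alpha^\pi$ be the image predicate, $\alpha^\pi(\pi(\xi_1),\dots,\pi(\xi_n))=\alpha(\xi_1,\dots,\xi_n)$.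 A finite set $P\subseteq I$ is a finite support of $\alpha$ (with respect to $\mathfrak{G}$) if $\alpha^\pi=\alpha$ for every $\pi\in\mathfrak{G}$ that fixes every element of $P$. Ackermann axioms: for $H\in\mathcal{L}^{(2)}_{x,D}$, $$choice_h^{1,1}(H)=\ \forall x\,\exists D\,H(x,D)\to\exists S\,\forall x\,\exists D\,\big(\forall y(Dy\leftrightarrow Sxy)\land H(x,D)\big),$$ where $S$ is a binary predicate variable not occurring in $H$. $\mathrm{HAC}=\{choice_h^{1,1}(H)\mid H\in\mathcal{L}^{(2)}_{x,D}\}$. *)

theory Defs
  imports Main "HOL-Combinatorics.Permutations"
begin

section \<open>Second-order language\<close>

type_synonym ivar = nat

datatype pvar = PVar (psort: nat) (pidx: nat)

datatype form =
    Eq ivar ivar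
  | Atom pvar "ivar list"
  | Neg form
  | Conj form form
  | Disj form form
  | Impl form form
  | Equiv form form
  | AllI ivar form
  | ExI ivar form
  | AllP pvar form
  | ExP pvar form

text \<open>The datatype also contains ill-sorted expressions (wrong number of arguments, predicate
  variables of sort 0); the language consists of the well-sorted ones.\<close>

primrec wf_form :: "form \<Rightarrow> bool" where
  "wf_form (Eq x y) \<longleftrightarrow> True"
| "wf_form (Atom P xs) \<longleftrightarrow> 1 \<le> psort P \<and> length xs = psort P"
| "wf_form (Neg A) \<longleftrightarrow> wf_form A"
| "wf_form (Conj A B) \<longleftrightarrow> wf_form A \<and> wf_form B"
| "wf_form (Disj A B) \<longleftrightarrow> wf_form A \<and> wf_form B"
| "wf_form (Impl A B) \<longleftrightarrow> wf_form A \<and> wf_form B"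
| "wf_form (Equiv A B) \<longleftrightarrow> wf_form A \<and> wf_form B"
| "wf_form (AllI x A) \<longleftrightarrow> wf_form A"
| "wf_form (ExI x A) \<longleftrightarrow> wf_form A"
| "wf_form (AllP P A) \<longleftrightarrow> 1 \<le> psort P \<and> wf_form A"
| "wf_form (ExP P A) \<longleftrightarrow> 1 \<le> psort P \<and> wf_form A"

definition L2 :: "form set" where
  "L2 = {A. wf_form A}"

primrec bound_ivars :: "form \<Rightarrow> ivar set" where
  "bound_ivars (Eq x y) = {}"
| "bound_ivars (Atom P xs) = {}"
| "bound_ivars (Neg A) = bound_ivars A"
| "bound_ivars (Conj A B) = bound_ivars A \<union> bound_ivars B"
| "bound_ivars (Disj A B) = bound_ivars A \<union> bound_ivars B"
| "bound_ivars (Impl A B) = bound_ivars A \<union> bound_ivars B"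
| "bound_ivars (Equiv A B) = bound_ivars A \<union> bound_ivars B"
| "bound_ivars (AllI x A) = insert x (bound_ivars A)"
| "bound_ivars (ExI x A) = insert x (bound_ivars A)"
| "bound_ivars (AllP P A) = bound_ivars A"
| "bound_ivars (ExP P A) = bound_ivars A"

primrec bound_pvars :: "form \<Rightarrow> pvar set" where
  "bound_pvars (Eq x y) = {}"
| "bound_pvars (Atom P xs) = {}"
| "bound_pvars (Neg A) = bound_pvars A"
| "bound_pvars (Conj A B) = bound_pvars A \<union> bound_pvars B"
| "bound_pvars (Disj A B) = bound_pvars A \<union> bound_pvars B"
| "bound_pvars (Impl A B) = bound_pvars A \<union> bound_pvars B"
| "bound_pvars (Equiv A B) = bound_pvars A \<union> bound_pvars B"
| "bound_pvars (AllI x A) = bound_pvars A"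
| "bound_pvars (ExI x A) = bound_pvars A"
| "bound_pvars (AllP P A) = insert P (bound_pvars A)"
| "bound_pvars (ExP P A) = insert P (bound_pvars A)"

text \<open>All predicate variables occurring in a formula, free or bound.\<close>

primrec pvars :: "form \<Rightarrow> pvar set" where
  "pvars (Eq x y) = {}"
| "pvars (Atom P xs) = {P}"
| "pvars (Neg A) = pvars A"
| "pvars (Conj A B) = pvars A \<union> pvars B"
| "pvars (Disj A B) = pvars A \<union> pvars B"
| "pvars (Impl A B) = pvars A \<union> pvars B"
| "pvars (Equiv A B) = pvars A \<union> pvars B"
| "pvars (AllI x A) = pvars A"
| "pvars (ExI x A) = pvars A"
| "pvars (AllP P A) = insert P (pvars A)"
| "pvars (ExP P A) = insert P (pvars A)"

definition L2xD :: "ivar \<Rightarrow> pvar \<Rightarrow> form set" where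
  "L2xD x D = {H \<in> L2. x \<notin> bound_ivars H \<and> D \<notin> bound_pvars H}"

section \<open>Predicate structures with Henkin semantics\<close>

text \<open>An \<open>n\<close>-ary predicate on \<open>I\<close> is represented by the subset of \<open>I\<^sup>n\<close> on which it is true,
  tuples being lists of length \<open>n\<close>.\<close>

definition tuples :: "'i set \<Rightarrow> nat \<Rightarrow> 'i list set" where
  "tuples I n = {xs. length xs = n \<and> set xs \<subseteq> I}"

text \<open>\<open>indiv\<close> is the domain \<open>J\<^sub>0\<close> and \<open>preds n\<close> is \<open>J\<^sub>n\<close> for \<open>n \<ge> 1\<close>; the component \<open>preds 0\<close>
  has no meaning and no formula of the language refers to it.\<close>

record 'i pstruct =
  indiv :: "'i set"
  preds :: "nat \<Rightarrow> 'i list set set"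

definition predicate_structure :: "'i pstruct \<Rightarrow> bool" where
  "predicate_structure \<Sigma> \<longleftrightarrow> indiv \<Sigma> \<noteq> {} \<and>
     (\<forall>n\<ge>1. preds \<Sigma> n \<noteq> {} \<and> preds \<Sigma> n \<subseteq> Pow (tuples (indiv \<Sigma>) n))"

definition assignment ::
    "'i pstruct \<Rightarrow> (ivar \<Rightarrow> 'i) \<Rightarrow> (pvar \<Rightarrow> 'i list set) \<Rightarrow> bool" where
  "assignment \<Sigma> f F \<longleftrightarrow>
     (\<forall>x. f x \<in> indiv \<Sigma>) \<and> (\<forall>P. 1 \<le> psort P \<longrightarrow> F P \<in> preds \<Sigma> (psort P))"

primrec sat ::
    "'i pstruct \<Rightarrow> form \<Rightarrow> (ivar \<Rightarrow> 'i) \<Rightarrow> (pvar \<Rightarrow> 'i list set) \<Rightarrow> bool" where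
  "sat \<Sigma> (Eq x y) f F \<longleftrightarrow> f x = f y"
| "sat \<Sigma> (Atom P xs) f F \<longleftrightarrow> map f xs \<in> F P"
| "sat \<Sigma> (Neg A) f F \<longleftrightarrow> \<not> sat \<Sigma> A f F"
| "sat \<Sigma> (Conj A B) f F \<longleftrightarrow> sat \<Sigma> A f F \<and> sat \<Sigma> B f F"
| "sat \<Sigma> (Disj A B) f F \<longleftrightarrow> sat \<Sigma> A f F \<or> sat \<Sigma> B f F"
| "sat \<Sigma> (Impl A B) f F \<longleftrightarrow> (sat \<Sigma> A f F \<longrightarrow> sat \<Sigma> B f F)"
| "sat \<Sigma> (Equiv A B) f F \<longleftrightarrow> (sat \<Sigma> A f F \<longleftrightarrow> sat \<Sigma> B f F)"
| "sat \<Sigma> (AllI x A) f F \<longleftrightarrow> (\<forall>a\<in>indiv \<Sigma>. sat \<Sigma> A (f(x := a)) F)"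
| "sat \<Sigma> (ExI x A) f F \<longleftrightarrow> (\<exists>a\<in>indiv \<Sigma>. sat \<Sigma> A (f(x := a)) F)"
| "sat \<Sigma> (AllP P A) f F \<longleftrightarrow> (\<forall>\<alpha>\<in>preds \<Sigma> (psort P). sat \<Sigma> A f (F(P := \<alpha>)))"
| "sat \<Sigma> (ExP P A) f F \<longleftrightarrow> (\<exists>\<alpha>\<in>preds \<Sigma> (psort P). sat \<Sigma> A f (F(P := \<alpha>)))"

definition models :: "'i pstruct \<Rightarrow> form \<Rightarrow> bool" where
  "models \<Sigma> A \<longleftrightarrow> (\<forall>f F. assignment \<Sigma> f F \<longrightarrow> sat \<Sigma> A f F)"

section \<open>Permutation models\<close>

text \<open>The truth set of \<open>\<alpha>\<^sup>\<pi>\<close>, where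
  \<open>\<alpha>\<^sup>\<pi>(\<pi> \<xi>\<^sub>1, \<dots>, \<pi> \<xi>\<^sub>n) = \<alpha>(\<xi>\<^sub>1, \<dots>, \<xi>\<^sub>n)\<close>.\<close>

definition perm_image :: "('i \<Rightarrow> 'i) \<Rightarrow> 'i list set \<Rightarrow> 'i list set" where
  "perm_image \<pi> \<alpha> = map \<pi> ` \<alpha>"

definition finite_support ::
    "'i set \<Rightarrow> ('i \<Rightarrow> 'i) set \<Rightarrow> 'i set \<Rightarrow> 'i list set \<Rightarrow> bool" where
  "finite_support I G P \<alpha> \<longleftrightarrow> finite P \<and> P \<subseteq> I \<and>
     (\<forall>\<pi>\<in>G. (\<forall>\<xi>\<in>P. \<pi> \<xi> = \<xi>) \<longrightarrow> perm_image \<pi> \<alpha> = \<alpha>)"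

definition finite_support_model :: "'i set \<Rightarrow> ('i \<Rightarrow> 'i) set \<Rightarrow> 'i pstruct" where
  "finite_support_model I G =
     \<lparr> indiv = I,
       preds = (\<lambda>n. {\<alpha>. \<alpha> \<subseteq> tuples I n \<and> (\<exists>P. finite_support I G P \<alpha>)}) \<rparr>"

definition basic_fraenkel :: "nat pstruct" where
  "basic_fraenkel = finite_support_model UNIV {\<pi>. \<pi> permutes UNIV}"

lemma predicate_structure_basic_fraenkel: "predicate_structure basic_fraenkel"
proof -
  have "{} \<in> preds basic_fraenkel n" for n
    by (auto simp: basic_fraenkel_def finite_support_model_def finite_support_def perm_image_def)
  then show ?thesis
    by (auto simp: predicate_structure_def basic_fraenkel_def finite_support_model_def)
qed

section \<open>Ackermann axioms of choice\<close>

text \<open>\<open>choice_h x D S y H\<close> is meant for \<open>D\<close> unary, \<open>S\<close> binary and not occurring in \<open>H\<close>, and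
  \<open>y \<noteq> x\<close>. The variable \<open>y\<close> may occur in \<open>H\<close>, since its quantifier does not reach \<open>H\<close>.\<close>

definition choice_h :: "ivar \<Rightarrow> pvar \<Rightarrow> pvar \<Rightarrow> ivar \<Rightarrow> form \<Rightarrow> form" where
  "choice_h x D S y H =
     Impl (AllI x (ExP D H))
       (ExP S (AllI x (ExP D
          (Conj (AllI y (Equiv (Atom D [y]) (Atom S [x, y]))) H))))"

definition HAC :: "form set" where
  "HAC = {choice_h x D S y H | x D S y H.
     psort D = 1 \<and> H \<in> L2xD x D \<and> psort S = 2 \<and> S \<notin> pvars H \<and> y \<noteq> x}"

end

theory Submission
  imports Defs
begin

text \<open>Truth in the Fraenkel model is invariant under permutations, so the relation \<open>H(x, D)\<close> is
  equivariant under all permutations that fix a finite set \<open>P\<close> of parameters. Take some \<open>a \<notin> P\<close>, a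
  witness \<open>D\<^sub>a\<close> for \<open>a\<close> and a finite support \<open>Q \<supseteq> P \<union> {a}\<close> of \<open>D\<^sub>a\<close>. For \<open>x \<notin> Q\<close> the transposition
  of \<open>a\<close> and \<open>x\<close> carries \<open>D\<^sub>a\<close> to a witness for \<open>x\<close>; for the finitely many \<open>x \<in> Q\<close> any witnesses
  will do. The resulting binary predicate is supported by \<open>Q\<close> together with supports of the
  witnesses chosen for the elements of \<open>Q\<close>.\<close>

text \<open>Bound variables are collected along with free ones, so a condition imposed on all
  occurring variables passes directly from a quantified formula to its body.\<close>

primrec ivars :: "form \<Rightarrow> ivar set" where
  "ivars (Eq x y) = {x, y}"
| "ivars (Atom P xs) = set xs"
| "ivars (Neg A) = ivars A"
| "ivars (Conj A B) = ivars A \<union> ivars B"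
| "ivars (Disj A B) = ivars A \<union> ivars B"
| "ivars (Impl A B) = ivars A \<union> ivars B"
| "ivars (Equiv A B) = ivars A \<union> ivars B"
| "ivars (AllI x A) = insert x (ivars A)"
| "ivars (ExI x A) = insert x (ivars A)"
| "ivars (AllP P A) = ivars A"
| "ivars (ExP P A) = ivars A"

lemma finite_ivars: "finite (ivars A)"
  by (induction A) auto

lemma finite_pvars: "finite (pvars A)"
  by (induction A) auto

lemma perm_image_comp: "perm_image (\<pi> \<circ> \<sigma>) \<alpha> = perm_image \<pi> (perm_image \<sigma> \<alpha>)"
  by (simp add: perm_image_def image_comp comp_def)

lemma perm_image_id [simp]: "perm_image id \<alpha> = \<alpha>"
  by (simp add: perm_image_def)

lemma map_mem_perm_image_iff: "inj \<pi> \<Longrightarrow> map \<pi> xs \<in> perm_image \<pi> \<alpha> \<longleftrightarrow> xs \<in> \<alpha>"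
  by (auto simp: perm_image_def inj_map_eq_map)

text \<open>\<open>\<pi>\<close> acts as an automorphism of \<open>\<Sigma>\<close>: it is a
  bijection of the individuals and maps every \<open>preds \<Sigma> n\<close> onto itself, so each
  quantifier can be reindexed along \<open>\<pi>\<close>. Agreement is required only at the finitely
  many occurring variables, which later permits finite supports.\<close>

lemma sat_perm_image:
  assumes \<pi>: "\<pi> permutes indiv \<Sigma>"
    and preds: "\<And>n. perm_image \<pi> ` preds \<Sigma> n = preds \<Sigma> n"
    and "\<And>z. z \<in> ivars A \<Longrightarrow> g z = \<pi> (f z)"
    and "\<And>P. P \<in> pvars A \<Longrightarrow> G P = perm_image \<pi> (F P)"
  shows "sat \<Sigma> A g G \<longleftrightarrow> sat \<Sigma> A f F"
  using assms(3,4)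
proof (induction A arbitrary: f g F G)
  case (Eq x y)
  then show ?case using permutes_inj[OF \<pi>] by (auto simp: inj_eq)
next
  case (Atom P xs)
  then have "map g xs = map \<pi> (map f xs)" and "G P = perm_image \<pi> (F P)" by simp_all
  then show ?case
    by (simp only: sat.simps map_mem_perm_image_iff[OF permutes_inj[OF \<pi>]])
next
  case (AllI x A)
  have "sat \<Sigma> A (g(x := \<pi> a)) G \<longleftrightarrow> sat \<Sigma> A (f(x := a)) F" for a
    by (rule AllI.IH) (use AllI.prems in auto)
  then have "(\<forall>b\<in>\<pi> ` indiv \<Sigma>. sat \<Sigma> A (g(x := b)) G) \<longleftrightarrow> (\<forall>a\<in>indiv \<Sigma>. sat \<Sigma> A (f(x := a)) F)"
    by simp
  then show ?case by (simp add: permutes_image[OF \<pi>])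
next
  case (ExI x A)
  have "sat \<Sigma> A (g(x := \<pi> a)) G \<longleftrightarrow> sat \<Sigma> A (f(x := a)) F" for a
    by (rule ExI.IH) (use ExI.prems in auto)
  then have "(\<exists>b\<in>\<pi> ` indiv \<Sigma>. sat \<Sigma> A (g(x := b)) G) \<longleftrightarrow> (\<exists>a\<in>indiv \<Sigma>. sat \<Sigma> A (f(x := a)) F)"
    by simp
  then show ?case by (simp add: permutes_image[OF \<pi>])
next
  case (AllP P A)
  have "sat \<Sigma> A g (G(P := perm_image \<pi> \<alpha>)) \<longleftrightarrow> sat \<Sigma> A f (F(P := \<alpha>))" for \<alpha>
    by (rule AllP.IH) (use AllP.prems in auto)
  then have "(\<forall>\<beta>\<in>perm_image \<pi> ` preds \<Sigma> (psort P). sat \<Sigma> A g (G(P := \<beta>))) \<longleftrightarrow>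
      (\<forall>\<alpha>\<in>preds \<Sigma> (psort P). sat \<Sigma> A f (F(P := \<alpha>)))"
    by simp
  then show ?case by (simp add: preds)
next
  case (ExP P A)
  have "sat \<Sigma> A g (G(P := perm_image \<pi> \<alpha>)) \<longleftrightarrow> sat \<Sigma> A f (F(P := \<alpha>))" for \<alpha>
    by (rule ExP.IH) (use ExP.prems in auto)
  then have "(\<exists>\<beta>\<in>perm_image \<pi> ` preds \<Sigma> (psort P). sat \<Sigma> A g (G(P := \<beta>))) \<longleftrightarrow>
      (\<exists>\<alpha>\<in>preds \<Sigma> (psort P). sat \<Sigma> A f (F(P := \<alpha>)))"
    by simp
  then show ?case by (simp add: preds)
next
  case (Neg A)
  have "sat \<Sigma> A g G \<longleftrightarrow> sat \<Sigma> A f F" by (rule Neg.IH) (use Neg.prems in auto)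
  then show ?case by simp
next
  case (Conj A B)
  have "sat \<Sigma> A g G \<longleftrightarrow> sat \<Sigma> A f F" by (rule Conj.IH) (use Conj.prems in auto)
  moreover have "sat \<Sigma> B g G \<longleftrightarrow> sat \<Sigma> B f F" by (rule Conj.IH) (use Conj.prems in auto)
  ultimately show ?case by simp
next
  case (Disj A B)
  have "sat \<Sigma> A g G \<longleftrightarrow> sat \<Sigma> A f F" by (rule Disj.IH) (use Disj.prems in auto)
  moreover have "sat \<Sigma> B g G \<longleftrightarrow> sat \<Sigma> B f F" by (rule Disj.IH) (use Disj.prems in auto)
  ultimately show ?case by simp
next
  case (Impl A B)
  have "sat \<Sigma> A g G \<longleftrightarrow> sat \<Sigma> A f F" by (rule Impl.IH) (use Impl.prems in auto)
  moreover have "sat \<Sigma> B g G \<longleftrightarrow> sat \<Sigma> B f F" by (rule Impl.IH) (use Impl.prems in auto)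
  ultimately show ?case by simp
next
  case (Equiv A B)
  have "sat \<Sigma> A g G \<longleftrightarrow> sat \<Sigma> A f F" by (rule Equiv.IH) (use Equiv.prems in auto)
  moreover have "sat \<Sigma> B g G \<longleftrightarrow> sat \<Sigma> B f F" by (rule Equiv.IH) (use Equiv.prems in auto)
  ultimately show ?case by simp
qed

text \<open>This is the instance of permutation invariance for the identity. It serves to change the
  value of a predicate variable that does not occur in the formula.\<close>

lemma sat_cong_pvars:
  assumes "\<And>P. P \<in> pvars A \<Longrightarrow> G P = F P"
  shows "sat \<Sigma> A f G \<longleftrightarrow> sat \<Sigma> A f F"
  by (rule sat_perm_image[where \<pi> = id]) (use assms in \<open>auto simp: permutes_id\<close>)

text \<open>The invariance clause of \<open>finite_support\<close> for the full symmetric group,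
  with finiteness split off so that it can be tracked separately.\<close>

definition supports :: "nat set \<Rightarrow> nat list set \<Rightarrow> bool" where
  "supports P \<alpha> \<longleftrightarrow> (\<forall>\<pi>. \<pi> permutes UNIV \<longrightarrow> (\<forall>\<xi>\<in>P. \<pi> \<xi> = \<xi>) \<longrightarrow> perm_image \<pi> \<alpha> = \<alpha>)"

lemma supportsD:
  "supports P \<alpha> \<Longrightarrow> \<pi> permutes UNIV \<Longrightarrow> (\<And>\<xi>. \<xi> \<in> P \<Longrightarrow> \<pi> \<xi> = \<xi>) \<Longrightarrow> perm_image \<pi> \<alpha> = \<alpha>"
  by (simp add: supports_def)

lemma indiv_basic_fraenkel [simp]: "indiv basic_fraenkel = UNIV"
  by (simp add: basic_fraenkel_def finite_support_model_def)

lemma preds_basic_fraenkel: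
  "\<alpha> \<in> preds basic_fraenkel n \<longleftrightarrow> \<alpha> \<subseteq> {xs. length xs = n} \<and> (\<exists>P. finite P \<and> supports P \<alpha>)"
  by (auto simp: basic_fraenkel_def finite_support_model_def finite_support_def tuples_def
      supports_def)

lemma supports_perm_image:
  assumes \<pi>: "\<pi> permutes UNIV" and P: "supports P \<alpha>"
  shows "supports (\<pi> ` P) (perm_image \<pi> \<alpha>)"
  unfolding supports_def
proof (intro allI impI)
  fix \<sigma> :: "nat \<Rightarrow> nat"
  assume \<sigma>: "\<sigma> permutes UNIV" and fixed: "\<forall>\<xi>\<in>\<pi> ` P. \<sigma> \<xi> = \<xi>"
  define \<rho> where "\<rho> = inv \<pi> \<circ> (\<sigma> \<circ> \<pi>)"
  have "\<rho> permutes UNIV"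
    unfolding \<rho>_def using \<pi> \<sigma> by (intro permutes_compose permutes_inv)
  then have "perm_image \<rho> \<alpha> = \<alpha>"
    by (rule supportsD[OF P]) (use fixed in \<open>simp add: \<rho>_def permutes_inverses[OF \<pi>]\<close>)
  moreover have "\<sigma> \<circ> \<pi> = \<pi> \<circ> \<rho>"
    by (simp add: \<rho>_def fun_eq_iff permutes_inverses[OF \<pi>])
  ultimately show "perm_image \<sigma> (perm_image \<pi> \<alpha>) = perm_image \<pi> \<alpha>"
    by (metis perm_image_comp)
qed

lemma perm_image_mem_preds:
  assumes \<pi>: "\<pi> permutes UNIV" and \<alpha>: "\<alpha> \<in> preds basic_fraenkel n"
  shows "perm_image \<pi> \<alpha> \<in> preds basic_fraenkel n"
proof -
  from \<alpha> obtain P where "finite P" "supports P \<alpha>" and "\<alpha> \<subseteq> {xs. length xs = n}"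
    by (auto simp: preds_basic_fraenkel)
  moreover from this have "perm_image \<pi> \<alpha> \<subseteq> {xs. length xs = n}"
    by (auto simp: perm_image_def)
  ultimately show ?thesis
    unfolding preds_basic_fraenkel using supports_perm_image[OF \<pi>] by blast
qed

lemma perm_image_preds:
  assumes \<pi>: "\<pi> permutes UNIV"
  shows "perm_image \<pi> ` preds basic_fraenkel n = preds basic_fraenkel n"
proof (intro equalityI subsetI)
  fix \<beta> assume "\<beta> \<in> preds basic_fraenkel n"
  then have "perm_image (inv \<pi>) \<beta> \<in> preds basic_fraenkel n"
    by (rule perm_image_mem_preds[OF permutes_inv[OF \<pi>]])
  moreover have "\<beta> = perm_image \<pi> (perm_image (inv \<pi>) \<beta>)"
    using permutes_inv_o(1)[OF \<pi>] by (metis perm_image_comp perm_image_id)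
  ultimately show "\<beta> \<in> perm_image \<pi> ` preds basic_fraenkel n" by blast
qed (use perm_image_mem_preds[OF \<pi>] in auto)

text \<open>The combinatorial core, with the formula abstracted to an equivariant relation
  \<open>\<Phi>\<close>. The last conclusion says that the binary predicate coding the choice
  function \<open>d\<close> belongs to the model.\<close>

lemma uniform_choice:
  fixes \<Phi> :: "nat \<Rightarrow> nat list set \<Rightarrow> bool"
  assumes P: "finite P"
    and total: "\<And>x. \<exists>\<delta>\<in>preds basic_fraenkel 1. \<Phi> x \<delta>"
    and equivariant: "\<And>\<pi> x \<delta>. \<pi> permutes UNIV \<Longrightarrow> (\<And>\<xi>. \<xi> \<in> P \<Longrightarrow> \<pi> \<xi> = \<xi>) \<Longrightarrow> \<Phi> x \<delta> \<Longrightarrow>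
      \<Phi> (\<pi> x) (perm_image \<pi> \<delta>)"
  obtains d where "\<And>x. d x \<in> preds basic_fraenkel 1" and "\<And>x. \<Phi> x (d x)"
    and "{[x, y] | x y. [y] \<in> d x} \<in> preds basic_fraenkel 2"
proof -
  from total obtain e
    where e_pred: "e x \<in> preds basic_fraenkel 1" and e: "\<Phi> x (e x)" for x
    by metis
  then have "\<forall>x. \<exists>T. finite T \<and> supports T (e x)"
    by (auto simp: preds_basic_fraenkel)
  then obtain T where T: "finite (T x)" "supports (T x) (e x)" for x
    by metis
  \<comment> \<open>With \<open>a\<close> outside \<open>P\<close>, the transposition of
    \<open>a\<close> with any other point outside \<open>P\<close> fixes \<open>P\<close> pointwise,
    so equivariance applies to it.\<close>
  obtain a where a: "a \<notin> P"
    using P ex_new_if_finite infinite_UNIV_nat by blast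
  define Q where "Q = insert a (P \<union> T a)"
  have Q: "finite Q" using P T by (simp add: Q_def)
  define \<tau> where "\<tau> x = transpose a x" for x
  have \<tau>: "\<tau> x permutes UNIV" for x by (simp add: \<tau>_def permutes_swap_id)
  define d where "d x = (if x \<in> Q then e x else perm_image (\<tau> x) (e a))" for x
  \<comment> \<open>A permutation fixing \<open>R\<close> pointwise preserves each of the finitely
    many witnesses \<open>e x\<close> with \<open>x \<in> Q\<close>, and it also fixes
    \<open>Q\<close> pointwise.\<close>
  define R where "R = Q \<union> (\<Union>x\<in>Q. T x)"
  have R: "finite R" using Q T by (simp add: R_def)
  have d_pred: "d x \<in> preds basic_fraenkel 1" for x
    unfolding d_def using e_pred perm_image_mem_preds[OF \<tau>] by auto
  have d: "\<Phi> x (d x)" for x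
  proof (cases "x \<in> Q")
    case False
    then have "\<tau> x \<xi> = \<xi>" if "\<xi> \<in> P" for \<xi>
      using that a unfolding \<tau>_def by (intro transpose_apply_other) (auto simp: Q_def)
    then have "\<Phi> (\<tau> x a) (perm_image (\<tau> x) (e a))"
      by (rule equivariant[OF \<tau> _ e])
    with False show ?thesis by (simp add: d_def \<tau>_def)
  qed (simp add: d_def e)
  \<comment> \<open>Equivariance of \<open>d\<close> itself is what makes \<open>R\<close> a support
    of the binary predicate.\<close>
  have d_equivariant: "perm_image \<pi> (d x) = d (\<pi> x)"
    if \<pi>: "\<pi> permutes UNIV" and fixed: "\<And>\<xi>. \<xi> \<in> R \<Longrightarrow> \<pi> \<xi> = \<xi>" for \<pi> x
  proof (cases "x \<in> Q")
    case True
    have "perm_image \<pi> (e x) = e x"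
      by (rule supportsD[OF T(2) \<pi>]) (use True fixed in \<open>auto simp: R_def\<close>)
    moreover have "\<pi> x = x" using True fixed by (simp add: R_def)
    ultimately show ?thesis using True by (simp add: d_def)
  next
    case False
    have fixQ: "\<pi> \<xi> = \<xi>" if "\<xi> \<in> Q" for \<xi> using that fixed by (simp add: R_def)
    \<comment> \<open>Otherwise \<open>\<pi>\<close> would fix \<open>\<pi> x\<close>, and
      injectivity would give \<open>\<pi> x = x\<close>, a point outside \<open>Q\<close>.\<close>
    have \<pi>x: "\<pi> x \<notin> Q"
      using False fixQ permutes_inj[OF \<pi>] by (metis injD)
    \<comment> \<open>\<open>\<rho>\<close> sends \<open>a\<close> to \<open>x\<close>, then to
      \<open>\<pi> x\<close>, then back to \<open>a\<close>. Any other point of \<open>T a\<close>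
      lies in \<open>Q\<close>, hence differs from \<open>x\<close> and \<open>\<pi> x\<close> and
      is left alone by all three factors. So \<open>\<rho>\<close> preserves \<open>e a\<close>, and
      the involution \<open>\<tau> (\<pi> x)\<close> can be moved to the other side.\<close>
    define \<rho> where "\<rho> = \<tau> (\<pi> x) \<circ> (\<pi> \<circ> \<tau> x)"
    have "\<rho> permutes UNIV"
      unfolding \<rho>_def by (intro permutes_compose \<tau> \<pi>)
    moreover have "\<rho> \<xi> = \<xi>" if "\<xi> \<in> T a" for \<xi>
    proof (cases "\<xi> = a")
      case True
      then show ?thesis by (simp add: \<rho>_def \<tau>_def)
    next
      case neq: False
      have "\<xi> \<in> Q" using that by (simp add: Q_def)
      then have "\<xi> \<noteq> x" "\<xi> \<noteq> \<pi> x" using False \<pi>x by auto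
      then show ?thesis using neq fixQ[OF \<open>\<xi> \<in> Q\<close>] by (simp add: \<rho>_def \<tau>_def)
    qed
    ultimately have "perm_image \<rho> (e a) = e a"
      by (rule supportsD[OF T(2)])
    moreover have "\<pi> \<circ> \<tau> x = \<tau> (\<pi> x) \<circ> \<rho>"
      by (simp add: \<rho>_def \<tau>_def fun_eq_iff)
    ultimately have "perm_image \<pi> (perm_image (\<tau> x) (e a)) = perm_image (\<tau> (\<pi> x)) (e a)"
      by (metis perm_image_comp)
    then show ?thesis using False \<pi>x by (simp add: d_def)
  qed
  let ?S = "{[x, y] | x y. [y] \<in> d x}"
  have "supports R ?S"
    unfolding supports_def
  proof (intro allI impI)
    fix \<pi> :: "nat \<Rightarrow> nat"
    assume \<pi>: "\<pi> permutes UNIV" and fixed: "\<forall>\<xi>\<in>R. \<pi> \<xi> = \<xi>"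
    have d_iff: "[\<pi> y] \<in> d (\<pi> x) \<longleftrightarrow> [y] \<in> d x" for x y
      using map_mem_perm_image_iff[OF permutes_inj[OF \<pi>], of "[y]" "d x"] d_equivariant[OF \<pi>] fixed
      by simp
    show "perm_image \<pi> ?S = ?S"
    proof (intro equalityI subsetI)
      fix xs assume "xs \<in> ?S"
      then obtain x y where xs: "xs = [x, y]" "[y] \<in> d x" by blast
      obtain x' y' where "x = \<pi> x'" "y = \<pi> y'"
        using permutes_surj[OF \<pi>] by (metis surjD)
      with xs d_iff have "xs = map \<pi> [x', y']" "[x', y'] \<in> ?S" by auto
      then show "xs \<in> perm_image \<pi> ?S" unfolding perm_image_def by (rule image_eqI)
    qed (use d_iff in \<open>auto simp: perm_image_def\<close>)
  qed
  with R have "?S \<in> preds basic_fraenkel 2"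
    unfolding preds_basic_fraenkel by auto
  with d_pred d show thesis by (rule that)
qed

text \<open>Supplies the equivariance that \<open>uniform_choice\<close> expects. The set
  \<open>P\<close> gathers the values of the individual variables of \<open>H\<close> and finite
  supports of the values of its predicate variables, so a permutation fixing \<open>P\<close> leaves
  all parameters unchanged.\<close>

lemma sat_equivariant:
  assumes F: "assignment basic_fraenkel f F" and H: "wf_form H"
  obtains P where "finite P"
    and "\<And>\<pi> b \<delta>. \<pi> permutes UNIV \<Longrightarrow> (\<And>\<xi>. \<xi> \<in> P \<Longrightarrow> \<pi> \<xi> = \<xi>) \<Longrightarrow>
      sat basic_fraenkel H (f(x := b)) (F(D := \<delta>)) \<Longrightarrow>
      sat basic_fraenkel H (f(x := \<pi> b)) (F(D := perm_image \<pi> \<delta>))"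
proof -
  \<comment> \<open>An assignment constrains only predicate variables of positive sort, so
    well-sortedness is what yields supports here.\<close>
  have sort: "1 \<le> psort V" if "V \<in> pvars H" for V
    using H that by (induction H) auto
  have "\<forall>V\<in>pvars H. \<exists>T. finite T \<and> supports T (F V)"
    using F sort by (auto simp: assignment_def preds_basic_fraenkel)
  then obtain T where T: "finite (T V)" "supports (T V) (F V)" if "V \<in> pvars H" for V
    by metis
  let ?P = "f ` ivars H \<union> (\<Union>V\<in>pvars H. T V)"
  show thesis
  proof (rule that)
    show "finite ?P" using T by (simp add: finite_ivars finite_pvars)
    fix \<pi> b \<delta>
    assume \<pi>: "\<pi> permutes UNIV" and fixed: "\<And>\<xi>. \<xi> \<in> ?P \<Longrightarrow> \<pi> \<xi> = \<xi>"
      and sat: "sat basic_fraenkel H (f(x := b)) (F(D := \<delta>))"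
    have "perm_image \<pi> (F V) = F V" if "V \<in> pvars H" for V
      by (rule supportsD[OF T(2)[OF that] \<pi>]) (use that fixed in auto)
    then have "sat basic_fraenkel H (f(x := \<pi> b)) (F(D := perm_image \<pi> \<delta>)) \<longleftrightarrow>
        sat basic_fraenkel H (f(x := b)) (F(D := \<delta>))"
      by (intro sat_perm_image perm_image_preds \<pi>) (use \<pi> fixed in auto)
    with sat show "sat basic_fraenkel H (f(x := \<pi> b)) (F(D := perm_image \<pi> \<delta>))" by simp
  qed
qed

theorem mainTheorem1:
  shows "\<forall>A\<in>HAC. models basic_fraenkel A"
proof
  fix A assume "A \<in> HAC"
  then obtain x D S y H where A: "A = choice_h x D S y H" and D: "psort D = 1" and S: "psort S = 2"
    and H: "wf_form H" and SH: "S \<notin> pvars H" and yx: "y \<noteq> x"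
    by (auto simp: HAC_def L2xD_def L2_def)
  have SD: "S \<noteq> D" using D S by auto
  show "models basic_fraenkel A"
    unfolding models_def
  proof (intro allI impI)
    fix f F assume F: "assignment basic_fraenkel f F"
    define \<Phi> where "\<Phi> b \<delta> = sat basic_fraenkel H (f(x := b)) (F(D := \<delta>))" for b \<delta>
    obtain P where P: "finite P"
      and equivariant: "\<And>\<pi> b \<delta>. \<pi> permutes UNIV \<Longrightarrow> (\<And>\<xi>. \<xi> \<in> P \<Longrightarrow> \<pi> \<xi> = \<xi>) \<Longrightarrow> \<Phi> b \<delta> \<Longrightarrow>
        \<Phi> (\<pi> b) (perm_image \<pi> \<delta>)"
      unfolding \<Phi>_def using sat_equivariant[OF F H, of x D] by blast
    show "sat basic_fraenkel A f F"
    proof (cases "\<forall>b. \<exists>\<delta>\<in>preds basic_fraenkel 1. \<Phi> b \<delta>")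
      \<comment> \<open>The premise of the choice axiom fails.\<close>
      case False
      then show ?thesis by (auto simp: A choice_h_def \<Phi>_def D)
    next
      case True
      obtain d where d_pred: "\<And>b. d b \<in> preds basic_fraenkel 1" and d: "\<And>b. \<Phi> b (d b)"
        and S_pred: "{[b, c] | b c. [c] \<in> d b} \<in> preds basic_fraenkel 2" (is "?S \<in> _")
        proof (rule uniform_choice[of P \<Phi>, OF P True[rule_format]])
          show "\<Phi> (\<pi> b) (perm_image \<pi> \<delta>)"
            if "\<pi> permutes UNIV" "\<And>\<xi>. \<xi> \<in> P \<Longrightarrow> \<pi> \<xi> = \<xi>" "\<Phi> b \<delta>" for \<pi> b \<delta>
            using that by (rule equivariant)
        qed (rule that)
      \<comment> \<open>Since \<open>S\<close> does not occur in \<open>H\<close>, assigning it the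
        coded choice function does not affect the truth of \<open>H\<close>.\<close>
      have "sat basic_fraenkel H (f(x := b)) (F(S := ?S, D := d b))" for b
        using d[of b] unfolding \<Phi>_def
        by (subst sat_cong_pvars[where F = "F(D := d b)"]) (use SH in auto)
      then have "\<forall>b. \<exists>\<delta>\<in>preds basic_fraenkel 1. (\<forall>c. [c] \<in> \<delta> \<longleftrightarrow> [b, c] \<in> ?S) \<and>
          sat basic_fraenkel H (f(x := b)) (F(S := ?S, D := \<delta>))"
        using d_pred by auto
      then have "sat basic_fraenkel (AllI x (ExP D
          (Conj (AllI y (Equiv (Atom D [y]) (Atom S [x, y]))) H))) f (F(S := ?S))"
        using yx SD SD[symmetric] D by simp
      with S_pred show ?thesis
        \<comment> \<open>Only the implication and the outer quantifier over \<open>S\<close> are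
          unfolded; what lies below keeps the form just proved, with \<open>?S\<close> as
          witness.\<close>
        unfolding A choice_h_def sat.simps(6,11) S by blast
    qed
  qed
qed

end
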